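(* Let $\varphi=(\varphi(1),\varphi(2),\dots,\varphi(k))$ be a finite sequence of (non-signed) diagonal flips transforming one triangulation (with no interior vertices) of an $n$-gon into another. Let $G(\varphi)$ and $\tilde{G}(\varphi)$ be the graphs associated with $\varphi$ (defined in the context). Then the following three statements are equivalent: (i) The sequence $\varphi$ can be lifted to a sequence of signed diagonal flips. (ii) $\tilde{G}(\varphi)$ is $2$-colorable (i.e. bipartite). (iii) $G(\varphi)$ is $2$-colorable.
   Context: Triangulations and flips. Fix a polygon with $n$ vertices, enumerated in cyclic order. A triangulation of the polygon means a triangulation with no interior vertices, all of whose vertices are the polygon's vertices, so it is given by a maximal set of pairwise non-crossing diagonals. Triangulations are treated combinatorially: any chord between two non-adjacent vertices is an admissible diagonal, as for a convex polygon. A triangle is identified with its set of three vertices, written $abc$, and a triangulation is identified with its set of triangles. If a triangulation contains two triangles $abc$ and $acd$ sharing the edge $ac$, with $a,b,c,d$ in cyclic order on the polygon, then a (non-signed) diagonal flip replaces them by $abd$ and $bcd$; that is, the diagonal $ac$ is replaced by $bd$, and all other triangles are unchanged. Flip sequences. A sequence of diagonal flips $\varphi(1),\dots,\varphi(k)$ comes with triangulations $T(1),\dots,T(k+1)$ of the same polygon, where $\varphi(i)$ transforms $T(i)$ into $T(i+1)$. For each $i$, let $X(i)$ (the removed set) be the set of the two triangles of $T(i)$ removed by $\varphi(i)$, and let $Y(i)$ (the inserted set) be the set of the two triangles of $T(i+1)$ inserted by $\varphi(i)$. Thus if $X(i)=\{abc,acd\}$, then $Y(i)=\{abd,bcd\}$.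 The flip $\varphi(i)$ is represented by the triple $(i,X(i),Y(i))$, so flips at different positions in the sequence are regarded as distinct. Signed flips. A signing of a triangulation assigns a sign $+$ or $-$ to each of its triangles. A signed diagonal flip is a diagonal flip performed on a signed triangulation such that the two removed triangles have the same sign, the two inserted triangles both receive the opposite sign, and every other triangle keeps its sign. The sequence $\varphi$ can be lifted to a sequence of signed diagonal flips if there are signings $\sigma_i:T(i)\to\{+,-\}$ for $i=1,\dots,k+1$ such that, for every $i=1,\dots,k$, the flip $\varphi(i)$ from $(T(i),\sigma_i)$ to $(T(i+1),\sigma_{i+1})$ is a signed diagonal flip. The graphs. Both $G(\varphi)$ and $\tilde{G}(\varphi)$ are simple graphs with vertex set $\{\varphi(1),\dots,\varphi(k)\}$ ($k$ distinct vertices, one for each position in the sequence). In $G(\varphi)$, for $i<j$, the vertices $\varphi(i)$ and $\varphi(j)$ are adjacent if and only if $Y(i)\cap X(j)\neq\emptyset$ and $$Y(i)\cap X(j)\not\subseteq\bigcup_{i<l<j}X(l).$$ In $\tilde{G}(\varphi)$, for $i<j$, the vertices $\varphi(i)$ and $\varphi(j)$ are adjacent if and only if $Y(i)\cap X(j)\neq\emptyset$. A graph is $2$-colorable if its vertices can be colored with two colors so that adjacent vertices have different colors. *)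

theory Defs
  imports Main
begin

text \<open>The vertices of the \<open>n\<close>-gon are \<open>0, \<dots>, n - 1\<close> in cyclic order. Edges and
  triangles are identified with their sets of vertices.\<close>

definition cyclic_order :: "nat \<Rightarrow> nat \<Rightarrow> nat \<Rightarrow> nat \<Rightarrow> bool" where
  "cyclic_order a b c d \<longleftrightarrow>
     a < b \<and> b < c \<and> c < d \<or> b < c \<and> c < d \<and> d < a \<or>
     c < d \<and> d < a \<and> a < b \<or> d < a \<and> a < b \<and> b < c"

definition sides :: "nat \<Rightarrow> nat set set" where
  "sides n = {{a, Suc a mod n} | a. a < n}"

definition diagonals :: "nat \<Rightarrow> nat set set" where
  "diagonals n = {{a, b} | a b. a < n \<and> b < n \<and> a \<noteq> b \<and> {a, b} \<notin> sides n}"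

definition crossing :: "nat set \<Rightarrow> nat set \<Rightarrow> bool" where
  "crossing e f \<longleftrightarrow> (\<exists>a b c d. cyclic_order a b c d \<and> e = {a, c} \<and> f = {b, d})"

definition noncrossing :: "nat \<Rightarrow> nat set set \<Rightarrow> bool" where
  "noncrossing n D \<longleftrightarrow> D \<subseteq> diagonals n \<and> (\<forall>e\<in>D. \<forall>f\<in>D. \<not> crossing e f)"

definition maximal_noncrossing :: "nat \<Rightarrow> nat set set \<Rightarrow> bool" where
  "maximal_noncrossing n D \<longleftrightarrow>
     noncrossing n D \<and> (\<forall>D'. noncrossing n D' \<and> D \<subseteq> D' \<longrightarrow> D' = D)"

text \<open>All vertices lie on the polygon, so no vertex or diagonal can lie inside a triangle whose
  edges are sides or chosen diagonals; each such triangle is a face.\<close>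

definition triangles :: "nat \<Rightarrow> nat set set \<Rightarrow> nat set set" where
  "triangles n D = {{a, b, c} | a b c. a < n \<and> b < n \<and> c < n \<and>
     a \<noteq> b \<and> b \<noteq> c \<and> a \<noteq> c \<and> {{a, b}, {b, c}, {a, c}} \<subseteq> sides n \<union> D}"

definition triangulation :: "nat \<Rightarrow> nat set set \<Rightarrow> bool" where
  "triangulation n T \<longleftrightarrow> (\<exists>D. maximal_noncrossing n D \<and> T = triangles n D)"

definition diagonal_flip ::
    "nat set set \<Rightarrow> nat set set \<Rightarrow> nat set set \<Rightarrow> nat set set \<Rightarrow> bool" where
  "diagonal_flip T X Y T' \<longleftrightarrow>
     (\<exists>a b c d. cyclic_order a b c d \<and>
        X = {{a, b, c}, {a, c, d}} \<and> Y = {{a, b, d}, {b, c, d}} \<and>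
        X \<subseteq> T \<and> T' = (T - X) \<union> Y)"

text \<open>A flip in a sequence is recorded as (position, removed set, inserted set).\<close>

type_synonym flip = "nat \<times> nat set set \<times> nat set set"

definition removed :: "flip \<Rightarrow> nat set set" where
  "removed f = fst (snd f)"

definition inserted :: "flip \<Rightarrow> nat set set" where
  "inserted f = snd (snd f)"

text \<open>Only the values of \<open>\<phi>\<close> on \<open>{1..k}\<close> and of \<open>T\<close> on \<open>{1..k+1}\<close> are relevant.\<close>

definition flip_sequence :: "nat \<Rightarrow> nat \<Rightarrow> (nat \<Rightarrow> nat set set) \<Rightarrow> (nat \<Rightarrow> flip) \<Rightarrow> bool" where
  "flip_sequence n k T \<phi> \<longleftrightarrow>
     (\<forall>i\<in>{1..k + 1}. triangulation n (T i)) \<and>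
     (\<forall>i\<in>{1..k}. \<exists>X Y. \<phi> i = (i, X, Y) \<and> diagonal_flip (T i) X Y (T (i + 1)))"

datatype sign = Positive | Negative

fun opposite :: "sign \<Rightarrow> sign" where
  "opposite Positive = Negative"
| "opposite Negative = Positive"

text \<open>A signing of \<open>T\<close> is a total function of which only the values on \<open>T\<close> matter.\<close>

definition signed_flip ::
    "nat set set \<Rightarrow> (nat set \<Rightarrow> sign) \<Rightarrow> nat set set \<Rightarrow> nat set set \<Rightarrow>
     nat set set \<Rightarrow> (nat set \<Rightarrow> sign) \<Rightarrow> bool" where
  "signed_flip T \<sigma> X Y T' \<sigma>' \<longleftrightarrow>
     diagonal_flip T X Y T' \<and>
     (\<exists>s. (\<forall>t\<in>X. \<sigma> t = s) \<and> (\<forall>t\<in>Y. \<sigma>' t = opposite s)) \<and>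
     (\<forall>t\<in>T - X. \<sigma>' t = \<sigma> t)"

definition liftable :: "nat \<Rightarrow> (nat \<Rightarrow> nat set set) \<Rightarrow> (nat \<Rightarrow> flip) \<Rightarrow> bool" where
  "liftable k T \<phi> \<longleftrightarrow>
     (\<exists>\<sigma> :: nat \<Rightarrow> nat set \<Rightarrow> sign. \<forall>i\<in>{1..k}.
        signed_flip (T i) (\<sigma> i) (removed (\<phi> i)) (inserted (\<phi> i)) (T (i + 1)) (\<sigma> (i + 1)))"

text \<open>A simple graph is a pair of a vertex set and a set of two-element edges.\<close>

type_synonym 'v graph = "'v set \<times> 'v set set"

definition two_colorable :: "'v graph \<Rightarrow> bool" where
  "two_colorable H \<longleftrightarrow>
     (\<exists>col :: 'v \<Rightarrow> bool. \<forall>u\<in>fst H. \<forall>v\<in>fst H. {u, v} \<in> snd H \<longrightarrow> col u \<noteq> col v)"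

definition graph_G :: "nat \<Rightarrow> (nat \<Rightarrow> flip) \<Rightarrow> flip graph" where
  "graph_G k \<phi> =
     (\<phi> ` {1..k},
      {{\<phi> i, \<phi> j} | i j. 1 \<le> i \<and> i < j \<and> j \<le> k \<and>
         inserted (\<phi> i) \<inter> removed (\<phi> j) \<noteq> {} \<and>
         \<not> inserted (\<phi> i) \<inter> removed (\<phi> j) \<subseteq> (\<Union>l\<in>{i<..<j}. removed (\<phi> l))})"

definition graph_G_tilde :: "nat \<Rightarrow> (nat \<Rightarrow> flip) \<Rightarrow> flip graph" where
  "graph_G_tilde k \<phi> =
     (\<phi> ` {1..k},
      {{\<phi> i, \<phi> j} | i j. 1 \<le> i \<and> i < j \<and> j \<le> k \<and>
         inserted (\<phi> i) \<inter> removed (\<phi> j) \<noteq> {}})"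

end

theory Submission imports Defs
begin

text \<open>The only hard implication is from a lift to a colouring of the larger graph. As in Tait's
  reformulation of the four colour theorem, a signed triangulation comes from a colouring of the
  polygon's vertices by the four elements of \<open>(\<int>/2)\<^sup>2\<close>, adjacent vertices having different
  colours: the sign of a triangle is the rotational sense in which the three nonzero elements appear
  as colour differences along its edges. A signed flip leaves the vertex colouring unchanged.
  So a triangle has the same sign whenever it is present, however often it is removed
  and reinserted, and colouring each flip by the sign of the triangles it removes works.\<close>

section \<open>Edges of a triangulation\<close>

lemma crossing_commute:
  assumes "crossing e f"
  shows "crossing f e"
proof -
  obtain a b c d where "cyclic_order a b c d" "e = {a, c}" "f = {b, d}"
    using assms unfolding crossing_def by blast
  moreover from this have "cyclic_order b c d a" "e = {c, a}"
    unfolding cyclic_order_def by auto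
  ultimately show ?thesis
    unfolding crossing_def by blast
qed

lemma crossing_interlacedI:
  assumes "a < b" "b < c" "c < d"
  shows "crossing {a, c} {b, d}"
  using assms unfolding crossing_def cyclic_order_def by blast

lemma interlaced_if_crossing:
  assumes "crossing {c, b} {p, q}" "c < b"
  shows "c < p \<and> p < b \<and> (q < c \<or> b < q) \<or> c < q \<and> q < b \<and> (p < c \<or> b < p)"
  using assms unfolding crossing_def cyclic_order_def doubleton_eq_iff by auto

lemma side_cases:
  assumes "{a, b} \<in> sides n" "a < b"
  shows "b = Suc a \<and> b < n \<or> a = 0 \<and> Suc b = n"
proof -
  obtain s where s: "s < n" "{a, b} = {s, Suc s mod n}"
    using assms(1) unfolding sides_def by blast
  show ?thesis
  proof (cases "Suc s = n")
    case True
    then show ?thesis using s assms(2) by (auto simp: doubleton_eq_iff)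
  next
    case False
    then have "Suc s mod n = Suc s" "Suc s < n" using s(1) by simp_all
    then show ?thesis using s assms(2) by (auto simp: doubleton_eq_iff)
  qed
qed

lemma Suc_side: "Suc a < n \<Longrightarrow> {a, Suc a} \<in> sides n"
  unfolding sides_def by (auto intro!: exI[of _ a])

lemma last_side: "0 < n \<Longrightarrow> {0, n - 1} \<in> sides n"
  unfolding sides_def by (auto intro!: exI[of _ "n - 1"])

text \<open>The ends of a side are consecutive or are \<open>0\<close> and \<open>n - 1\<close>, so
  all other vertices below \<open>n\<close> lie on one side of it.\<close>

lemma not_crossing_side:
  assumes "{a, b} \<in> sides n" "p < n" "q < n"
  shows "\<not> crossing {a, b} {p, q}"
proof
  assume cr: "crossing {a, b} {p, q}"
  have "a \<noteq> b"
    using cr unfolding crossing_def cyclic_order_def doubleton_eq_iff by auto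
  then consider "a < b" | "b < a" by linarith
  then show False
  proof cases
    case 1
    then show False
      using side_cases[OF assms(1) 1] interlaced_if_crossing[OF cr 1] assms(2,3) by auto
  next
    case 2
    have "{b, a} \<in> sides n" "crossing {b, a} {p, q}"
      using assms(1) cr by (simp_all add: insert_commute)
    then show False
      using side_cases[OF _ 2] interlaced_if_crossing[OF _ 2] assms(2,3) by fastforce
  qed
qed

lemma edge_endpoints:
  assumes "D \<subseteq> diagonals n" "e \<in> sides n \<union> D"
  obtains p q where "e = {p, q}" "p < n" "q < n"
proof -
  from assms(2) show ?thesis
  proof
    assume "e \<in> sides n"
    then obtain a where "a < n" "e = {a, Suc a mod n}"
      unfolding sides_def by blast
    then show ?thesis by (intro that[of a "Suc a mod n"]) auto
  next
    assume "e \<in> D"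
    then show ?thesis using assms(1) that unfolding diagonals_def by blast
  qed
qed

text \<open>\<open>noncrossing\<close> speaks only of chosen diagonals. No chord between vertices
  crosses a side, so the sides can be adjoined to \<open>D\<close>.\<close>

lemma edges_not_crossing:
  assumes "noncrossing n D" "e \<in> sides n \<union> D" "f \<in> sides n \<union> D"
  shows "\<not> crossing e f"
proof
  assume cr: "crossing e f"
  have D: "D \<subseteq> diagonals n" using assms(1) unfolding noncrossing_def by blast
  obtain a b where e: "e = {a, b}" "a < n" "b < n" using edge_endpoints[OF D assms(2)] .
  obtain p q where f: "f = {p, q}" "p < n" "q < n" using edge_endpoints[OF D assms(3)] .
  have "e \<notin> sides n" using not_crossing_side cr e f by blast
  moreover have "f \<notin> sides n" using not_crossing_side crossing_commute[OF cr] e f by blast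
  ultimately show False
    using assms cr unfolding noncrossing_def by blast
qed

lemma triangle_edge:
  assumes "t \<in> triangles n D" "p \<in> t" "q \<in> t" "p \<noteq> q"
  shows "{p, q} \<in> sides n \<union> D"
proof -
  obtain a b c where abc: "t = {a, b, c}" "{{a, b}, {b, c}, {a, c}} \<subseteq> sides n \<union> D"
    using assms(1) unfolding triangles_def by (elim CollectE exE conjE) (rule that)
  have "{p, q} = {a, b} \<or> {p, q} = {b, c} \<or> {p, q} = {a, c}"
    using assms(2-4) abc(1) by auto
  then show ?thesis using abc(2) by auto
qed

lemma triangle_bound:
  assumes "t \<in> triangles n D" "p \<in> t"
  shows "p < n"
proof -
  obtain a b c where "t = {a, b, c}" "a < n" "b < n" "c < n"
    using assms(1) unfolding triangles_def by (elim CollectE exE conjE) (rule that)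
  then show ?thesis using assms(2) by auto
qed

lemma diagonal_flipE:
  assumes "diagonal_flip T X Y T'"
  obtains a b c d where "cyclic_order a b c d" "X = {{a, b, c}, {a, c, d}}"
    "Y = {{a, b, d}, {b, c, d}}" "X \<subseteq> T" "T' = (T - X) \<union> Y"
  using assms unfolding diagonal_flip_def by (elim exE conjE) (rule that)

text \<open>Both inserted triangles contain the edge \<open>{b, d}\<close>, which crosses the edge
  \<open>{a, c}\<close> already present.\<close>

lemma flip_inserts_new:
  assumes "triangulation n T" "diagonal_flip T X Y T'"
  shows "Y \<inter> T = {}"
proof -
  obtain D where D: "noncrossing n D" "T = triangles n D"
    using assms(1) unfolding triangulation_def maximal_noncrossing_def by blast
  obtain a b c d where f: "cyclic_order a b c d" "X = {{a, b, c}, {a, c, d}}"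
      "Y = {{a, b, d}, {b, c, d}}" "X \<subseteq> T"
    using diagonal_flipE[OF assms(2)] .
  have ne: "a \<noteq> c" "b \<noteq> d" using f(1) unfolding cyclic_order_def by auto
  have "{a, b, c} \<in> triangles n D" using f(2,4) D(2) by simp
  then have ac: "{a, c} \<in> sides n \<union> D"
    using triangle_edge ne by simp
  have "{b, d} \<in> sides n \<union> D" if "t \<in> Y" "t \<in> T" for t
    using triangle_edge[of t n D b d] that f(3) D(2) ne by auto
  then show ?thesis
    using edges_not_crossing[OF D(1) ac] f(1) unfolding crossing_def by blast
qed

text \<open>The apex is the last vertex before \<open>b\<close> joined to \<open>a\<close>: a diagonal crossing its chord to \<open>b\<close>
  could only start at \<open>a\<close>, and would end at a later vertex.\<close>

lemma obtain_apex:
  assumes max: "maximal_noncrossing n D" and ab: "{a, b} \<in> sides n \<union> D"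
    and b: "Suc a < b" "b < n"
  obtains c where "a < c" "c < b" "{a, c} \<in> sides n \<union> D" "{c, b} \<in> sides n \<union> D"
proof -
  let ?E = "sides n \<union> D"
  have nc: "noncrossing n D" using max unfolding maximal_noncrossing_def by blast
  have D: "D \<subseteq> diagonals n" using nc unfolding noncrossing_def by blast
  define C where "C = {c. a < c \<and> c < b \<and> {a, c} \<in> ?E}"
  \<comment> \<open>The side leaving \<open>a\<close> is a first candidate, so the maximum
    exists.\<close>
  have "Suc a \<in> C" using b Suc_side[of a n] unfolding C_def by auto
  moreover have fin: "finite C" unfolding C_def by (rule finite_subset[of _ "{..<b}"]) auto
  ultimately have "Max C \<in> C" by (intro Max_in) auto
  then obtain c where c: "a < c" "c < b" "{a, c} \<in> ?E" and cmax: "\<And>p. p \<in> C \<Longrightarrow> p \<le> c"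
    using fin unfolding C_def by (metis (mono_tags, lifting) Max_ge C_def mem_Collect_eq)
  have outer: False if p: "c < p" "p < b" "q < c \<or> b < q" and pq: "{p, q} \<in> D" for p q
  proof -
    have "q < n" using D pq unfolding diagonals_def by (auto simp: doubleton_eq_iff)
    consider "q < a" | "q = a" | "a < q" "q < c" | "b < q" using p(3) c by linarith
    then show False
    proof cases
      case 1
      have "crossing {q, p} {a, b}" using crossing_interlacedI[of q a p b] 1 c p by simp
      then show False using edges_not_crossing[OF nc] pq ab by (metis UnI2 insert_commute)
    next
      case 2
      then have "p \<in> C" using pq p c unfolding C_def by (simp add: insert_commute)
      then show False using cmax p by force
    next
      case 3
      have "crossing {a, c} {q, p}" using crossing_interlacedI[of a q c p] 3 p by simp
      then show False using edges_not_crossing[OF nc] pq c by (metis UnI2 insert_commute)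
    next
      case 4
      have "crossing {a, b} {p, q}" using crossing_interlacedI[of a p b q] 4 c p by simp
      then show False using edges_not_crossing[OF nc] pq ab by (metis UnI2)
    qed
  qed
  have "{c, b} \<in> ?E"
  proof (rule ccontr)
    assume not: "{c, b} \<notin> ?E"
    have diag: "{c, b} \<in> diagonals n"
      using not c b unfolding diagonals_def by fastforce
    have no_cross: "\<not> crossing {c, b} f" if "f \<in> D" for f
    proof
      assume cr: "crossing {c, b} f"
      obtain p q where f: "f = {p, q}" using D \<open>f \<in> D\<close> unfolding diagonals_def by blast
      show False
        using interlaced_if_crossing[of c b p q] cr f c(2) outer[of p q] outer[of q p] \<open>f \<in> D\<close>
        by (auto simp: insert_commute)
    qed
    \<comment> \<open>\<open>noncrossing\<close> also compares a diagonal with itself. Once this is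
      settled, maximality of \<open>D\<close> forces \<open>{c, b}\<close> into
      \<open>D\<close>.\<close>
    have "\<not> crossing {c, b} {c, b}"
      using interlaced_if_crossing[of c b c b] c(2) by auto
    then have "noncrossing n (insert {c, b} D)"
      using nc diag no_cross crossing_commute unfolding noncrossing_def by blast
    then have "insert {c, b} D = D"
      using max unfolding maximal_noncrossing_def by blast
    then show False using not by blast
  qed
  then show ?thesis using that c by blast
qed

text \<open>If \<open>p < c < r\<close>, some edge of the triangle crosses \<open>{a, c}\<close> or
  \<open>{c, b}\<close> unless the triangle is the one on \<open>a\<close>, \<open>c\<close>,
  \<open>b\<close>.\<close>

lemma triangle_below_edge_cases:
  assumes nc: "noncrossing n D"
    and ac: "{a, c} \<in> sides n \<union> D" and cb: "{c, b} \<in> sides n \<union> D"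
    and t: "{p, q, r} \<in> triangles n D" and ord: "a \<le> p" "p < q" "q < r" "r \<le> b"
  shows "r \<le> c \<or> c \<le> p \<or> p = a \<and> q = c \<and> r = b"
proof (rule ccontr)
  assume H: "\<not> ?thesis"
  have pr: "{p, r} \<in> sides n \<union> D" and pq: "{p, q} \<in> sides n \<union> D"
    and qr: "{q, r} \<in> sides n \<union> D"
    using triangle_edge[OF t] ord by auto
  have "p = a"
    using edges_not_crossing[OF nc ac pr] crossing_interlacedI[of a p c r] H ord by fastforce
  have "r = b"
    using edges_not_crossing[OF nc pr cb] crossing_interlacedI[of p c r b] H ord by fastforce
  have "\<not> q < c"
    using edges_not_crossing[OF nc ac qr] crossing_interlacedI[of a q c r] H ord \<open>p = a\<close>
    by fastforce
  moreover have "\<not> c < q"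
    using edges_not_crossing[OF nc pq cb] crossing_interlacedI[of p c q b] H ord \<open>r = b\<close>
    by fastforce
  ultimately show False using H \<open>p = a\<close> \<open>r = b\<close> by auto
qed

section \<open>Vertex colourings realising a signing\<close>

type_synonym color = "bool \<times> bool"

text \<open>Addition in (Z/2)^2, which is also subtraction.\<close>

definition difference :: "color \<Rightarrow> color \<Rightarrow> color" where
  "difference x y = (fst x \<noteq> fst y, snd x \<noteq> snd y)"

text \<open>Multiplication by a generator of \<open>\<F>\<^sub>4\<^sup>*\<close>, which permutes the nonzero colours
  \<open>(1,0)\<close>, \<open>(0,1)\<close>, \<open>(1,1)\<close> cyclically.\<close>

definition rotate_color :: "color \<Rightarrow> color" where
  "rotate_color x = (snd x, fst x \<noteq> snd x)"

text \<open>For distinct colours the differences around the triangle are the three nonzero elements.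
  They sum to zero, so the first two determine which of the two cyclic orders occurs.\<close>

definition positive_turn :: "color \<Rightarrow> color \<Rightarrow> color \<Rightarrow> bool" where
  "positive_turn x y z \<longleftrightarrow> difference y z = rotate_color (difference x y)"

lemmas color_defs = positive_turn_def rotate_color_def difference_def

text \<open>Two colours differ from both \<open>x\<close> and \<open>z\<close>. Exchanging them
  swaps the differences to \<open>x\<close> and to \<open>z\<close>, which reverses the sense, so
  each sense occurs once.\<close>

lemma obtain_middle_color:
  assumes "x \<noteq> z"
  obtains y where "y \<noteq> x" "y \<noteq> z" "positive_turn x y z \<longleftrightarrow> s"
proof -
  have "\<exists>y1 y2. (y1, y2) \<noteq> x \<and> (y1, y2) \<noteq> z \<and> (positive_turn x (y1, y2) z \<longleftrightarrow> s)"
    using assms by (cases x; cases z; cases s) (auto simp: color_defs)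
  then show ?thesis using that by blast
qed

lemma positive_turn_rotate:
  assumes "x \<noteq> y" "y \<noteq> z" "x \<noteq> z"
  shows "positive_turn y z x \<longleftrightarrow> positive_turn x y z"
  using assms by (cases x; cases y; cases z) (auto simp: color_defs)

text \<open>Equal senses force opposite sides of the quadrilateral \<open>x y z w\<close> to have
  equal differences, and the four colours to be distinct. Both triangles on the new diagonal then
  meet the three nonzero differences in reverse cyclic order.\<close>

lemma positive_turn_flip:
  assumes "x \<noteq> y" "y \<noteq> z" "x \<noteq> z" "z \<noteq> w" "x \<noteq> w"
    and "positive_turn x y z \<longleftrightarrow> positive_turn x z w"
  shows "y \<noteq> w" "positive_turn x y w \<longleftrightarrow> \<not> positive_turn x y z"
    "positive_turn y z w \<longleftrightarrow> \<not> positive_turn x y z"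
  using assms unfolding color_defs prod_eq_iff fst_conv snd_conv by argo+

text \<open>A triangle is a set and carries no orientation. This fixes the orientation in which its
  sign is read; by \<open>matches_rotate\<close> the starting vertex is immaterial.\<close>

definition cyclic3 :: "nat \<Rightarrow> nat \<Rightarrow> nat \<Rightarrow> bool" where
  "cyclic3 a b c \<longleftrightarrow> a < b \<and> b < c \<or> b < c \<and> c < a \<or> c < a \<and> a < b"

definition matches :: "(nat \<Rightarrow> color) \<Rightarrow> nat \<Rightarrow> nat \<Rightarrow> nat \<Rightarrow> sign \<Rightarrow> bool" where
  "matches v a b c s \<longleftrightarrow> v a \<noteq> v b \<and> v b \<noteq> v c \<and> v a \<noteq> v c \<and>
     (positive_turn (v a) (v b) (v c) \<longleftrightarrow> s = Positive)"

definition realises :: "(nat \<Rightarrow> color) \<Rightarrow> nat set set \<Rightarrow> (nat set \<Rightarrow> sign) \<Rightarrow> bool" where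
  "realises v T \<sigma> \<longleftrightarrow>
     (\<forall>a b c. cyclic3 a b c \<longrightarrow> {a, b, c} \<in> T \<longrightarrow> matches v a b c (\<sigma> {a, b, c}))"

lemma matches_rotate: "matches v b c a s \<longleftrightarrow> matches v a b c s"
  unfolding matches_def using positive_turn_rotate[of "v a" "v b" "v c"] by metis

lemma matches_cong:
  "\<lbrakk>v a = w a; v b = w b; v c = w c\<rbrakk> \<Longrightarrow> matches v a b c s \<longleftrightarrow> matches w a b c s"
  unfolding matches_def by simp

lemma sign_eq_if_matches: "\<lbrakk>matches v a b c s; matches v a b c s'\<rbrakk> \<Longrightarrow> s = s'"
  unfolding matches_def by (cases s; cases s') auto

text \<open>Reversing a triple destroys \<open>cyclic3\<close>, so only rotations remain, and
  \<open>matches\<close> is invariant under these.\<close>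

lemma cyclic3_unique:
  assumes "cyclic3 a b c" "cyclic3 p q r" "{p, q, r} = {a, b, c}"
  shows "(p, q, r) = (a, b, c) \<or> (p, q, r) = (b, c, a) \<or> (p, q, r) = (c, a, b)"
proof -
  have "p \<in> {a, b, c}" "q \<in> {a, b, c}" "r \<in> {a, b, c}"
    using assms(3) by blast+
  moreover have "p \<noteq> q" "q \<noteq> r" "p \<noteq> r"
    using assms(2) unfolding cyclic3_def by auto
  moreover have "\<not> cyclic3 b a c" "\<not> cyclic3 a c b" "\<not> cyclic3 c b a"
    using assms(1) unfolding cyclic3_def by auto
  ultimately show ?thesis using assms(2) by (elim insertE emptyE) simp_all
qed

section \<open>Existence of a realising colouring\<close>

text \<open>Induction on \<open>b - a\<close>: the apex triangle splits the part below
  \<open>{a, b}\<close> into the parts below \<open>{a, c}\<close> and \<open>{c, b}\<close>.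
  Keeping \<open>x\<close> and \<open>y\<close> arbitrary lets the two smaller instances share a
  prescribed colour at \<open>c\<close>.\<close>

lemma obtain_coloring_below_edge:
  assumes max: "maximal_noncrossing n D"
    and "{a, b} \<in> sides n \<union> D" "a < b" "b < n" "x \<noteq> y"
  obtains v where "v a = x" "v b = y"
    "\<And>p q r. \<lbrakk>a \<le> p; p < q; q < r; r \<le> b; {p, q, r} \<in> triangles n D\<rbrakk>
       \<Longrightarrow> matches v p q r (\<sigma> {p, q, r})"
proof -
  have nc: "noncrossing n D" using max unfolding maximal_noncrossing_def by blast
  have "\<exists>v. v a = x \<and> v b = y \<and> (\<forall>p q r. a \<le> p \<longrightarrow> p < q \<longrightarrow> q < r \<longrightarrow> r \<le> b \<longrightarrow>
      {p, q, r} \<in> triangles n D \<longrightarrow> matches v p q r (\<sigma> {p, q, r}))"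
    using assms(2-)
  proof (induction "b - a" arbitrary: a b x y rule: less_induct)
    case less
    show ?case
    proof (cases "b = Suc a")
      case True
      then show ?thesis using less.prems by (intro exI[of _ "\<lambda>i. if i = a then x else y"]) auto
    next
      case False
      then have "Suc a < b" using less.prems by simp
      then obtain c where c: "a < c" "c < b" and
          ac: "{a, c} \<in> sides n \<union> D" and cb: "{c, b} \<in> sides n \<union> D"
        using obtain_apex[OF max less.prems(1)] less.prems by blast
      \<comment> \<open>The sign of the apex triangle forces the colour of its third vertex.\<close>
      obtain z where z: "z \<noteq> x" "z \<noteq> y" "positive_turn x z y \<longleftrightarrow> \<sigma> {a, c, b} = Positive"
        using obtain_middle_color[OF less.prems(4)] by metis
      obtain v where v: "v a = x" "v c = z" "\<And>p q r. \<lbrakk>a \<le> p; p < q; q < r; r \<le> c;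
          {p, q, r} \<in> triangles n D\<rbrakk> \<Longrightarrow> matches v p q r (\<sigma> {p, q, r})"
        using less.hyps[of c a x z] c ac z less.prems by force
      obtain w where w: "w c = z" "w b = y" "\<And>p q r. \<lbrakk>c \<le> p; p < q; q < r; r \<le> b;
          {p, q, r} \<in> triangles n D\<rbrakk> \<Longrightarrow> matches w p q r (\<sigma> {p, q, r})"
        using less.hyps[of b c z y] c cb z less.prems by force
      \<comment> \<open>Both pieces give \<open>c\<close> the colour \<open>z\<close>, so
        \<open>u\<close> agrees with each of them up to and including \<open>c\<close>.\<close>
      define u where "u i = (if i \<le> c then v i else w i)" for i
      have uv: "u i = v i" if "i \<le> c" for i using that unfolding u_def by simp
      have uw: "u i = w i" if "c \<le> i" for i
        using that v(2) w(1) unfolding u_def by auto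
      have "matches u p q r (\<sigma> {p, q, r})"
        if ord: "a \<le> p" "p < q" "q < r" "r \<le> b" and t: "{p, q, r} \<in> triangles n D" for p q r
      proof -
        consider "r \<le> c" | "c \<le> p" | "p = a" "q = c" "r = b"
          using triangle_below_edge_cases[OF nc ac cb t ord] by blast
        then show ?thesis
        proof cases
          case 1
          then show ?thesis
            using v(3)[OF ord(1-3) _ t] matches_cong[of u p v q r] uv ord by simp
        next
          case 2
          then show ?thesis
            using w(3)[OF _ ord(2-4) t] matches_cong[of u p w q r] uw ord by simp
        next
          case 3
          have "u a = x" "u c = z" "u b = y" using uv uw v w c by simp_all
          then show ?thesis using 3 z less.prems(4) unfolding matches_def by auto
        qed
      qed
      moreover have "u a = x" "u b = y" using uv uw v w c by simp_all
      ultimately show ?thesis by blast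
    qed
  qed
  then show ?thesis using that by blast
qed

lemma obtain_realising_coloring:
  assumes "triangulation n T" "n \<ge> 2"
  obtains v where "realises v T \<sigma>"
proof -
  obtain D where D: "maximal_noncrossing n D" "T = triangles n D"
    using assms(1) unfolding triangulation_def by blast
  \<comment> \<open>All triangles lie below the closing side \<open>{0, n - 1}\<close>. Its ends may
    receive any two distinct colours.\<close>
  have base: "{0, n - 1} \<in> sides n \<union> D" "0 < n - 1" "n - 1 < n" "(True, True) \<noteq> (False, False)"
    using last_side[of n] assms(2) by auto
  obtain v where v: "\<And>p q r. \<lbrakk>0 \<le> p; p < q; q < r; r \<le> n - 1; {p, q, r} \<in> triangles n D\<rbrakk>
       \<Longrightarrow> matches v p q r (\<sigma> {p, q, r})"
    using obtain_coloring_below_edge[OF D(1) base, of \<sigma>] by metis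
  have sorted: "matches v p q r (\<sigma> {p, q, r})" if "p < q" "q < r" "{p, q, r} \<in> T" for p q r
    using v[of p q r] that D(2) triangle_bound[of "{p, q, r}" n D r] by auto
  have "matches v a b c (\<sigma> {a, b, c})" if "cyclic3 a b c" "{a, b, c} \<in> T" for a b c
  proof -
    have perm: "{b, c, a} = {a, b, c}" "{c, a, b} = {a, b, c}" by auto
    show ?thesis
      using that sorted[of a b c] sorted[of b c a] sorted[of c a b]
        matches_rotate[of v a b c] matches_rotate[of v b c a]
      unfolding cyclic3_def perm by blast
  qed
  then show ?thesis using that unfolding realises_def by blast
qed

section \<open>Invariance under signed flips\<close>

lemma cyclic_order_imp_cyclic3:
  assumes "cyclic_order a b c d"
  shows "cyclic3 a b c" "cyclic3 a c d" "cyclic3 a b d" "cyclic3 b c d"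
  using assms unfolding cyclic_order_def cyclic3_def by auto

text \<open>Surviving triangles keep both sign and colours. On the flipped quadrilateral
  \<open>positive_turn_flip\<close> reverses the common sense exactly as the signed flip reverses
  the common sign.\<close>

lemma realises_signed_flip:
  assumes re: "realises v T \<sigma>" and fl: "signed_flip T \<sigma> X Y T' \<sigma>'"
  shows "realises v T' \<sigma>'"
proof -
  have "diagonal_flip T X Y T'" using fl unfolding signed_flip_def by blast
  then obtain a b c d where f: "cyclic_order a b c d" "X = {{a, b, c}, {a, c, d}}"
      "Y = {{a, b, d}, {b, c, d}}" "X \<subseteq> T" "T' = (T - X) \<union> Y"
    by (rule diagonal_flipE)
  obtain s where s: "\<forall>t\<in>X. \<sigma> t = s" "\<forall>t\<in>Y. \<sigma>' t = opposite s" "\<forall>t\<in>T - X. \<sigma>' t = \<sigma> t"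
    using fl unfolding signed_flip_def by blast
  note cyc = cyclic_order_imp_cyclic3[OF f(1)]
  have X: "{a, b, c} \<in> X" "{a, c, d} \<in> X" using f(2) by simp_all
  then have "matches v a b c (\<sigma> {a, b, c})" "matches v a c d (\<sigma> {a, c, d})"
    using re cyc(1,2) f(4) unfolding realises_def by blast+
  then have "matches v a b c s" "matches v a c d s"
    using s(1) X by simp_all
  then have new: "matches v a b d (opposite s)" "matches v b c d (opposite s)"
    using positive_turn_flip[of "v a" "v b" "v c" "v d"] unfolding matches_def
    by (cases s; auto)+
  have "matches v p q r (\<sigma>' {p, q, r})" if pqr: "cyclic3 p q r" "{p, q, r} \<in> T'" for p q r
  proof (cases "{p, q, r} \<in> Y")
    case True
    then have sign: "\<sigma>' {p, q, r} = opposite s" using s(2) by blast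
    from True f(3) have "{p, q, r} = {a, b, d} \<or> {p, q, r} = {b, c, d}" by simp
    then show ?thesis
      using cyclic3_unique[OF cyc(3) pqr(1)] cyclic3_unique[OF cyc(4) pqr(1)] new
        matches_rotate[of v q r p] matches_rotate[of v p q r]
      unfolding sign by auto
  next
    case False
    then have "{p, q, r} \<in> T - X" using pqr f(5) by blast
    then show ?thesis using re pqr(1) s(3) unfolding realises_def by auto
  qed
  then show ?thesis unfolding realises_def by blast
qed

lemma triangulation_triangle_cyclic3:
  assumes "triangulation n T" "t \<in> T"
  obtains a b c where "cyclic3 a b c" "t = {a, b, c}"
proof -
  obtain D where "t \<in> triangles n D"
    using assms unfolding triangulation_def by blast
  then obtain a b c where t: "t = {a, b, c}" "a \<noteq> b" "b \<noteq> c" "a \<noteq> c"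
    unfolding triangles_def by (elim CollectE exE conjE) (rule that)
  then have "cyclic3 a b c \<or> cyclic3 a c b" unfolding cyclic3_def by linarith
  then show ?thesis using t(1) that[of a b c] that[of a c b] by (auto simp: insert_commute)
qed

section \<open>Flip sequences\<close>

lemma flip_sequenceD:
  assumes "flip_sequence n k T \<phi>" "i \<in> {1..k}"
  shows "triangulation n (T i)" "fst (\<phi> i) = i"
    "diagonal_flip (T i) (removed (\<phi> i)) (inserted (\<phi> i)) (T (i + 1))"
    "removed (\<phi> i) \<subseteq> T i" "inserted (\<phi> i) \<inter> T i = {}"
    "T (i + 1) = (T i - removed (\<phi> i)) \<union> inserted (\<phi> i)"
proof -
  show tri: "triangulation n (T i)" using assms unfolding flip_sequence_def by auto
  obtain X Y where XY: "\<phi> i = (i, X, Y)" "diagonal_flip (T i) X Y (T (i + 1))"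
    using assms unfolding flip_sequence_def by blast
  then show "fst (\<phi> i) = i" by simp
  show fl: "diagonal_flip (T i) (removed (\<phi> i)) (inserted (\<phi> i)) (T (i + 1))"
    using XY unfolding removed_def inserted_def by simp
  show "inserted (\<phi> i) \<inter> T i = {}" using flip_inserts_new[OF tri fl] .
  show "removed (\<phi> i) \<subseteq> T i" "T (i + 1) = (T i - removed (\<phi> i)) \<union> inserted (\<phi> i)"
    using diagonal_flipE[OF fl] by metis+
qed

section \<open>From a lift to a colouring of the larger graph\<close>

lemma two_colorable_graph_G_tilde_if_liftable:
  assumes n: "n \<ge> 2" and fs: "flip_sequence n k T \<phi>" and lift: "liftable k T \<phi>"
  shows "two_colorable (graph_G_tilde k \<phi>)"
proof -
  obtain \<sigma> where \<sigma>: "\<And>i. i \<in> {1..k} \<Longrightarrow> signed_flip (T i) (\<sigma> i) (removed (\<phi> i))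
      (inserted (\<phi> i)) (T (i + 1)) (\<sigma> (i + 1))"
    using lift unfolding liftable_def by blast
  have tri: "triangulation n (T i)" if "i \<in> {1..k + 1}" for i
    using fs that unfolding flip_sequence_def by blast
  obtain v where v: "realises v (T 1) (\<sigma> 1)"
    using obtain_realising_coloring[OF tri n] by auto
  \<comment> \<open>One and the same \<open>v\<close>, chosen for the first signing, serves every
    position.\<close>
  have re: "realises v (T i) (\<sigma> i)" if "1 \<le> i" "i \<le> k + 1" for i
    using that
  proof (induction i rule: dec_induct)
    case base
    show ?case by (rule v)
  next
    case (step i)
    then show ?case using realises_signed_flip[OF _ \<sigma>[of i]] by simp
  qed
  \<comment> \<open>Both signs are read off from \<open>v\<close>, which does not depend on the
    position.\<close>
  have const: "\<sigma> i t = \<sigma> j t"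
    if H: "i \<in> {1..k + 1}" "j \<in> {1..k + 1}" "t \<in> T i" "t \<in> T j" for i j t
  proof -
    obtain a b c where "cyclic3 a b c" "t = {a, b, c}"
      using triangulation_triangle_cyclic3[OF tri[OF H(1)] H(3)] .
    then have "matches v a b c (\<sigma> i t)" "matches v a b c (\<sigma> j t)"
      using re[of i] re[of j] H unfolding realises_def by auto
    then show ?thesis by (rule sign_eq_if_matches)
  qed
  \<comment> \<open>The removed triangles share one sign, so the existential quantifier is no
    choice. The first component of a flip recovers the position at which to evaluate
    \<open>\<sigma>\<close>.\<close>
  define col :: "flip \<Rightarrow> bool" where
    "col f \<longleftrightarrow> (\<exists>t\<in>removed f. \<sigma> (fst f) t = Positive)" for f
  have col: "(t \<in> removed (\<phi> i) \<longrightarrow> (col (\<phi> i) \<longleftrightarrow> \<sigma> i t = Positive)) \<and>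
      (t \<in> inserted (\<phi> i) \<longrightarrow> (col (\<phi> i) \<longleftrightarrow> \<sigma> (i + 1) t \<noteq> Positive))"
    if i: "i \<in> {1..k}" for i t
  proof -
    obtain s where s: "\<forall>t\<in>removed (\<phi> i). \<sigma> i t = s"
        "\<forall>t\<in>inserted (\<phi> i). \<sigma> (i + 1) t = opposite s"
      using \<sigma>[OF i] unfolding signed_flip_def by blast
    moreover have "removed (\<phi> i) \<noteq> {}"
      by (rule diagonal_flipE[OF flip_sequenceD(3)[OF fs i]]) simp
    ultimately show ?thesis
      using flip_sequenceD(2)[OF fs i] unfolding col_def by (cases s) auto
  qed
  have ne: "col (\<phi> i) \<noteq> col (\<phi> j)"
    if ij: "1 \<le> i" "i < j" "j \<le> k" and t: "t \<in> inserted (\<phi> i)" "t \<in> removed (\<phi> j)" for i j t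
  proof -
    have mem: "i \<in> {1..k}" "j \<in> {1..k}" "i + 1 \<in> {1..k + 1}" "j \<in> {1..k + 1}"
      using ij by auto
    have "t \<in> T (i + 1)" "t \<in> T j"
      using t flip_sequenceD(6)[OF fs mem(1)] flip_sequenceD(4)[OF fs mem(2)] by blast+
    \<comment> \<open>An inserted triangle is first signed at \<open>i + 1\<close>, a removed one
      last at \<open>j\<close>; any removals and reinsertions in between do no harm.\<close>
    then have "\<sigma> (i + 1) t = \<sigma> j t" using const mem by blast
    then show ?thesis using col[OF mem(1), of t] col[OF mem(2), of t] t by auto
  qed
  show ?thesis
    unfolding two_colorable_def graph_G_tilde_def
  proof (intro exI[of _ col] ballI impI)
    fix f g
    assume "{f, g} \<in> snd (\<phi> ` {1..k}, {{\<phi> i, \<phi> j} | i j. 1 \<le> i \<and> i < j \<and> j \<le> k \<and>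
         inserted (\<phi> i) \<inter> removed (\<phi> j) \<noteq> {}})"
    then obtain i j t where "{f, g} = {\<phi> i, \<phi> j}" "1 \<le> i" "i < j" "j \<le> k"
        "t \<in> inserted (\<phi> i)" "t \<in> removed (\<phi> j)" by auto
    then show "col f \<noteq> col g" using ne[of i j t] by (auto simp: doubleton_eq_iff)
  qed
qed

section \<open>From colourings of the graphs to lifts\<close>

text \<open>Same vertices, and every edge of \<open>graph_G\<close> is one of
  \<open>graph_G_tilde\<close>, so the same colouring works.\<close>

lemma two_colorable_graph_G_if_graph_G_tilde:
  assumes "two_colorable (graph_G_tilde k \<phi>)"
  shows "two_colorable (graph_G k \<phi>)"
proof -
  have vertices: "fst (graph_G k \<phi>) = fst (graph_G_tilde k \<phi>)"
    and edges: "snd (graph_G k \<phi>) \<subseteq> snd (graph_G_tilde k \<phi>)"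
    unfolding graph_G_def graph_G_tilde_def by auto
  obtain col :: "flip \<Rightarrow> bool" where col: "\<forall>u\<in>fst (graph_G_tilde k \<phi>). \<forall>v\<in>fst (graph_G_tilde k \<phi>).
      {u, v} \<in> snd (graph_G_tilde k \<phi>) \<longrightarrow> col u \<noteq> col v"
    using assms unfolding two_colorable_def ..
  show ?thesis
    unfolding two_colorable_def vertices using col edges by (intro exI[of _ col]) (simp add: subset_eq)
qed

text \<open>The sign given by a colouring \<open>c\<close> of the positions: opposite to the colour of the last insertion,
  and before any insertion the colour of the first removal (junk if there is none).\<close>

fun induced_signing :: "(nat \<Rightarrow> flip) \<Rightarrow> (nat \<Rightarrow> sign) \<Rightarrow> nat \<Rightarrow> nat set \<Rightarrow> sign" where
  "induced_signing \<phi> c 0 t = c (LEAST j. 1 \<le> j \<and> t \<in> removed (\<phi> j))"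
| "induced_signing \<phi> c (Suc i) t =
     (if 1 \<le> i \<and> t \<in> inserted (\<phi> i) then opposite (c i) else induced_signing \<phi> c i t)"

text \<open>Traces a triangle that is present back to its last insertion, or else to
  \<open>T 1\<close>. It cannot have been removed since, so its sign is the one acquired
  there.\<close>

lemma induced_signing_cases:
  assumes fs: "flip_sequence n k T \<phi>" and i: "1 \<le> i" "i \<le> k + 1" and t: "t \<in> T i"
  obtains (inserted) l where "1 \<le> l" "l < i" "t \<in> inserted (\<phi> l)"
      "\<And>m. l < m \<Longrightarrow> m < i \<Longrightarrow> t \<notin> removed (\<phi> m)"
      "induced_signing \<phi> c i t = opposite (c l)"
    | (original) "\<And>m. 1 \<le> m \<Longrightarrow> m < i \<Longrightarrow> t \<notin> removed (\<phi> m)"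
      "induced_signing \<phi> c i t = c (LEAST j. 1 \<le> j \<and> t \<in> removed (\<phi> j))"
proof -
  have "(\<exists>l. 1 \<le> l \<and> l < i \<and> t \<in> inserted (\<phi> l) \<and>
        (\<forall>m. l < m \<longrightarrow> m < i \<longrightarrow> t \<notin> removed (\<phi> m)) \<and>
        induced_signing \<phi> c i t = opposite (c l)) \<or>
      (\<forall>m. 1 \<le> m \<longrightarrow> m < i \<longrightarrow> t \<notin> removed (\<phi> m)) \<and>
      induced_signing \<phi> c i t = c (LEAST j. 1 \<le> j \<and> t \<in> removed (\<phi> j))"
    using i t
  proof (induction i rule: dec_induct)
    case base
    then show ?case by auto
  next
    case (step i)
    have mem: "i \<in> {1..k}" using step by auto
    show ?case
    proof (cases "t \<in> inserted (\<phi> i)")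
      case True
      then show ?thesis using step.hyps by (intro disjI1 exI[of _ i]) auto
    next
      case False
      then have "t \<in> T i" "t \<notin> removed (\<phi> i)"
        using step.prems flip_sequenceD(6)[OF fs mem] by auto
      then show ?thesis using step.IH mem False by (auto simp: less_Suc_eq)
    qed
  qed
  then show ?thesis using that by blast
qed

text \<open>The last insertion of a triangle before a removal is joined to that removal by an edge
  of \<open>graph_G\<close>. Hence the induced sign of every triangle removed at \<open>i\<close> is
  \<open>c i\<close>, and the two removed triangles agree.\<close>

lemma liftable_if_two_colorable_graph_G:
  assumes fs: "flip_sequence n k T \<phi>" and G: "two_colorable (graph_G k \<phi>)"
  shows "liftable k T \<phi>"
proof -
  obtain col :: "flip \<Rightarrow> bool" where col: "\<forall>f\<in>fst (graph_G k \<phi>). \<forall>g\<in>fst (graph_G k \<phi>).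
      {f, g} \<in> snd (graph_G k \<phi>) \<longrightarrow> col f \<noteq> col g"
    using G unfolding two_colorable_def ..
  define c where "c i = (if col (\<phi> i) then Positive else Negative)" for i
  have ne: "opposite (c i) = c j"
    if "1 \<le> i" "i < j" "j \<le> k" "t \<in> inserted (\<phi> i)" "t \<in> removed (\<phi> j)"
      "\<And>l. \<lbrakk>i < l; l < j\<rbrakk> \<Longrightarrow> t \<notin> removed (\<phi> l)" for i j t
  proof -
    have "{\<phi> i, \<phi> j} \<in> snd (graph_G k \<phi>)"
      unfolding graph_G_def snd_conv mem_Collect_eq
    proof (rule exI[of _ i], rule exI[of _ j], intro conjI)
      show "inserted (\<phi> i) \<inter> removed (\<phi> j) \<noteq> {}"
        using that(4,5) by blast
      \<comment> \<open>The triangle \<open>t\<close> itself is the element missed by the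
        union.\<close>
      show "\<not> inserted (\<phi> i) \<inter> removed (\<phi> j) \<subseteq> (\<Union>l\<in>{i<..<j}. removed (\<phi> l))"
        using that(4-6) by auto
    qed (use that(1-3) in simp_all)
    moreover have "\<phi> i \<in> fst (graph_G k \<phi>)" "\<phi> j \<in> fst (graph_G k \<phi>)"
      using that(1-3) unfolding graph_G_def by simp_all
    ultimately have "col (\<phi> i) \<noteq> col (\<phi> j)" using col by blast
    then show ?thesis unfolding c_def by auto
  qed
  let ?\<sigma> = "induced_signing \<phi> c"
  have "signed_flip (T i) (?\<sigma> i) (removed (\<phi> i)) (inserted (\<phi> i)) (T (i + 1)) (?\<sigma> (i + 1))"
    if i: "i \<in> {1..k}" for i
  proof -
    note D = flip_sequenceD[OF fs i]
    have "?\<sigma> i t = c i" if t: "t \<in> removed (\<phi> i)" for t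
    proof -
      have "t \<in> T i" "1 \<le> i" "i \<le> k + 1" using D(4) t i by auto
      from fs this(2,3,1) show ?thesis
      proof (cases rule: induced_signing_cases[where c = c])
        case (inserted l)
        then show ?thesis using ne[of l i t] t i by simp
      next
        case original
        \<comment> \<open>A triangle present from the start has its first removal at
          \<open>i\<close>, so its initial sign was chosen to be \<open>c i\<close>.\<close>
        have "(LEAST j. 1 \<le> j \<and> t \<in> removed (\<phi> j)) = i"
          using t i original(1) by (intro Least_equality) (auto simp: not_less[symmetric])
        then show ?thesis using original(2) by simp
      qed
    qed
    moreover have "?\<sigma> (i + 1) t = opposite (c i)" if "t \<in> inserted (\<phi> i)" for t
      using that i by simp
    \<comment> \<open>Inserted triangles are absent from \<open>T i\<close>, so the recursion leaves
      the sign of a survivor alone.\<close>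
    moreover have "?\<sigma> (i + 1) t = ?\<sigma> i t" if "t \<in> T i - removed (\<phi> i)" for t
      using that D(5) by auto
    ultimately show ?thesis using D(3) unfolding signed_flip_def by blast
  qed
  then show ?thesis unfolding liftable_def by (intro exI[of _ ?\<sigma>] ballI)
qed

theorem mainTheorem1:
  fixes n k :: nat and T :: "nat \<Rightarrow> nat set set" and \<phi> :: "nat \<Rightarrow> flip"
  assumes "n \<ge> 3"
    and "flip_sequence n k T \<phi>"
  shows "(liftable k T \<phi> \<longleftrightarrow> two_colorable (graph_G_tilde k \<phi>)) \<and>
         (two_colorable (graph_G_tilde k \<phi>) \<longleftrightarrow> two_colorable (graph_G k \<phi>))"
proof -
  have "n \<ge> 2" using assms(1) by simp
  \<comment> \<open>The three implications close a cycle.\<close>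
  then show ?thesis
    using two_colorable_graph_G_tilde_if_liftable[OF _ assms(2)]
      two_colorable_graph_G_if_graph_G_tilde liftable_if_two_colorable_graph_G[OF assms(2)]
    by blast
qed

end
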